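(* Let $\underline{n}=(n_1,\dots,n_m)$ be a composition of $N=\sum_{i=1}^m n_i$. The generalized Igusa function associated with $\underline{n}$ satisfies the functional equation $$I^{\mathrm{wo}}_{\underline{n}}(\mathbf{Y}^{-1};\mathbf{X}^{-1})=(-1)^N X_{v_{\underline{n}}}\left(\prod_{i=1}^m Y_i^{-\binom{n_i}{2}}\right)I^{\mathrm{wo}}_{\underline{n}}(\mathbf{Y};\mathbf{X}),$$ where $\mathbf{Y}^{-1}$ and $\mathbf{X}^{-1}$ mean that every variable is replaced by its inverse.
   Context: A composition of $N$ with $m$ parts is a sequence $(n_1,\dots,n_m)$ of non-negative integers with $\sum_{i=1}^m n_i=N$. $[k]=\{1,\dots,k\}$ (empty for $k\le 0$). Gaussian binomials: $\binom{a}{b}_Y=\prod_{i=a-b+1}^a(1-Y^i)\big/\prod_{i=1}^b(1-Y^i)\in\mathbb{Z}[Y]$ for integers $a\ge b\ge0$. Gaussian multinomials: for $J=\{j_1<\dots<j_r\}\subseteq[k-1]$, $\binom{k}{J}_Y=\binom{k}{j_r}_Y\binom{j_r}{j_{r-1}}_Y\cdots\binom{j_2}{j_1}_Y$ (equal to $1$ for $J=\varnothing$). $C_{\underline{n}}$ is the poset of subwords $a_1^{\alpha_1}\cdots a_m^{\alpha_m}$ ($0\le\alpha_i\le n_i$) of the word $v_{\underline{n}}=a_1^{n_1}\cdots a_m^{n_m}$ in letters $a_1,\dots,a_m$, ordered by $a_1^{\alpha_1}\cdots a_m^{\alpha_m}\le a_1^{\beta_1}\cdots a_m^{\beta_m}$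 iff $\alpha_i\le\beta_i$ for all $i$. Write $\pi_i(a_1^{\alpha_1}\cdots a_m^{\alpha_m})=\alpha_i$. $\mathrm{WO}_{\underline{n}}$ is the set of (possibly empty) flags $V=\{v_1<\dots<v_t\}$ of non-empty words in $C_{\underline{n}}$ (the word $v_{\underline{n}}$ itself is allowed). For such $V$ put $\varphi_i(V)=\{\pi_i(v_j)\mid j\in[t]\}\cap[n_i-1]$ for $i\in[m]$, $$W_V(\mathbf{X})=\prod_{j=1}^t\frac{X_{v_j}}{1-X_{v_j}},\qquad \binom{\underline{n}}{V}_{\mathbf{Y}}=\prod_{i=1}^m\binom{n_i}{\varphi_i(V)}_{Y_i}.$$ The generalized Igusa function associated with $\underline{n}$ is $$I^{\mathrm{wo}}_{\underline{n}}(\mathbf{Y};\mathbf{X})=\sum_{V\in\mathrm{WO}_{\underline{n}}}\binom{\underline{n}}{V}_{\mathbf{Y}}W_V(\mathbf{X})\in\mathbb{Q}(Y_1,\dots,Y_m,(X_v)_{v\le v_{\underline{n}}}).$$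
   Formalization: The formal statement assumes N ≥ 1: for N = 0 the only flag is empty, so the Igusa function is 1 and the equation would read 1 = X_v for the empty word v, which is false with X_v a variable. *)

theory Defs
  imports
    "HOL-Library.Poly_Mapping"
    "HOL-Library.Countable"
    "HOL-Computational_Algebra.Fraction_Field"
begin

text \<open>
  A composition \<open>n = (n_1, \<dots>, n_m)\<close> is a list of length \<open>m\<close>; the paper's index \<open>i \<in> [m]\<close>
  corresponds to the list position \<open>i - 1 < m\<close>. The word \<open>a_1^{\<alpha>_1} \<dots> a_m^{\<alpha>_m}\<close> is
  represented by its list of exponents \<open>[\<alpha>_1, \<dots>, \<alpha>_m]\<close>. Thus \<open>v_n\<close> is the list \<open>n\<close>
  itself, the empty word is the zero list, the order on words is \<open>list_all2 (\<le>)\<close>, and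
  \<open>\<pi>_i v\<close> is \<open>v ! (i - 1)\<close>.
\<close>

definition subwords :: "nat list \<Rightarrow> nat list set" where
  "subwords n = {\<alpha>. list_all2 (\<le>) \<alpha> n}"

definition empty_word :: "nat list \<Rightarrow> nat list" where
  "empty_word n = replicate (length n) 0"

definition WO :: "nat list \<Rightarrow> nat list set set" where
  "WO n = {V. V \<subseteq> subwords n - {empty_word n} \<and> Complete_Partial_Order.chain (list_all2 (\<le>)) V}"

text \<open>
  Truncated subtraction is harmless in \<open>n ! i - 1\<close>: the interval is empty for \<open>n ! i \<le> 1\<close>.
\<close>

definition flag_proj :: "nat list \<Rightarrow> nat list set \<Rightarrow> nat \<Rightarrow> nat set" where
  "flag_proj n V i = (\<lambda>v. v ! i) ` V \<inter> {1..n ! i - 1}"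

text \<open>
  For \<open>a \<ge> b\<close> this is the value of the Gaussian binomial at \<open>Y\<close> whenever \<open>Y\<close> is not a root of
  unity, so in particular when \<open>Y\<close> is a variable or the inverse of a variable in a field of
  rational functions.
\<close>

definition gauss_binomial :: "nat \<Rightarrow> nat \<Rightarrow> 'a::field \<Rightarrow> 'a" where
  "gauss_binomial a b Y = (\<Prod>i = a - b + 1..a. 1 - Y ^ i) / (\<Prod>i = 1..b. 1 - Y ^ i)"

text \<open>
  With \<open>js = [j_1, \<dots>, j_r, k]\<close>, the factors are the binomials of \<open>j_{s+1}\<close> over \<open>j_s\<close>,
  the last one being \<open>k\<close> over \<open>j_r\<close>.
\<close>

definition gauss_multinomial :: "nat \<Rightarrow> nat set \<Rightarrow> 'a::field \<Rightarrow> 'a" where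
  "gauss_multinomial k J Y =
    (let js = sorted_list_of_set J @ [k]
     in \<Prod>s<card J. gauss_binomial (js ! (s + 1)) (js ! s) Y)"

definition flag_multinomial :: "nat list \<Rightarrow> nat list set \<Rightarrow> (nat \<Rightarrow> 'a::field) \<Rightarrow> 'a" where
  "flag_multinomial n V Y = (\<Prod>i<length n. gauss_multinomial (n ! i) (flag_proj n V i) (Y i))"

definition flag_weight :: "nat list set \<Rightarrow> (nat list \<Rightarrow> 'a::field) \<Rightarrow> 'a" where
  "flag_weight V X = (\<Prod>v\<in>V. X v / (1 - X v))"

definition igusa_wo :: "nat list \<Rightarrow> (nat \<Rightarrow> 'a::field) \<Rightarrow> (nat list \<Rightarrow> 'a) \<Rightarrow> 'a" where
  "igusa_wo n Y X = (\<Sum>V\<in>WO n. flag_multinomial n V Y * flag_weight V X)"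

text \<open>
  The field of rational functions over the rationals in variables \<open>Y_i\<close> (indexed by all naturals)
  and \<open>X_v\<close> (indexed by all exponent lists), as fraction field of the polynomial ring. For a given
  \<open>n\<close> it contains the field of rational functions in the variables attached to \<open>n\<close>; the other
  variables are not used. The linear order on variables has no mathematical role: it is only needed
  for the library's proof that the polynomial ring is an integral domain.
\<close>

datatype var = YVar nat | XVar "nat list"

instance var :: countable
  by countable_datatype

instantiation var :: linorder
begin

definition less_eq_var :: "var \<Rightarrow> var \<Rightarrow> bool" where
  "(x::var) \<le> y \<longleftrightarrow> to_nat x \<le> to_nat y"

definition less_var :: "var \<Rightarrow> var \<Rightarrow> bool" where
  "(x::var) < y \<longleftrightarrow> to_nat x < to_nat y"

instance
  by standard (auto simp: less_eq_var_def less_var_def)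

end

type_synonym ratfun = "((var \<Rightarrow>\<^sub>0 nat) \<Rightarrow>\<^sub>0 rat) fract"

definition variable :: "var \<Rightarrow> ratfun" where
  "variable x = Fract (Poly_Mapping.single (Poly_Mapping.single x 1) 1) 1"

definition gen_Y :: "nat \<Rightarrow> ratfun" where
  "gen_Y i = variable (YVar i)"

definition gen_X :: "nat list \<Rightarrow> ratfun" where
  "gen_X v = variable (XVar v)"

end

theory Submission
  imports Defs
begin

text \<open>
  The functional equation comes from a recursion and an inversion formula. Write \<open>I(w)\<close> for the
  generalized Igusa function of a word \<open>w\<close>, write \<open>B(w, u)\<close> for the product over all letters of
  the Gaussian binomials of \<open>w_i\<close> over \<open>u_i\<close>, and set \<open>X_0 = 1\<close> for the empty word \<open>0\<close>.

  A flag has a top, its largest word, or the empty word if the flag is empty. The multinomial of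
  a flag with top \<open>u\<close>, taken in \<open>w\<close>, is \<open>B(w, u)\<close> times its multinomial in \<open>u\<close>; and the flags
  with top \<open>u\<close> contribute \<open>X_u I(u)\<close> to the sum for \<open>u\<close>, because allowing \<open>u\<close> in a flag multiplies
  the weight by \<open>1 + X_u / (1 - X_u) = 1 / (1 - X_u)\<close>, while requiring it gives \<open>X_u / (1 - X_u)\<close>.
  Grouping flags by their tops yields (\<open>igusa_wo_recursion\<close>)
  \<open>I(w) = \<Sum>u\<le>w. B(w, u) X_u I(u)\<close>.
  Since \<open>X_u \<noteq> 1\<close> for \<open>u \<noteq> 0\<close>, this determines \<open>I\<close> from \<open>I(0)\<close> (\<open>word_recursion_unique\<close>).

  Gaussian inversion (\<open>gauss_inversion\<close>), which holds letter by letter, solves the recursion for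
  the other occurrence of \<open>I\<close>:
  \<open>X_w I(w) = \<Sum>u\<le>w. s(w, u) B(w, u) I(u)\<close>, where \<open>s(w, u)\<close> is the product of the
  \<open>(-1)^d Y_i^{d choose 2}\<close> with \<open>d = w_i - u_i\<close>. Let \<open>\<epsilon>(w)\<close> be the product of the
  \<open>(-1)^{w_i} Y_i^{-(w_i choose 2)}\<close>. Inverting the variables multiplies \<open>B(w, u)\<close>
  by \<open>s(w, u) \<epsilon>(w) / \<epsilon>(u)\<close> (\<open>word_binomial_inverse\<close>), so the last identity becomes the
  statement that \<open>w \<mapsto> \<epsilon>(w) X_w I(w)\<close> satisfies the recursion with all variables inverted. By
  uniqueness it is the Igusa function in the inverted variables, which is the functional equation.

  The argument works over any field, with nonzero values \<open>Y_i\<close> that are not roots of unity and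
  values \<open>X_v\<close> different from \<open>0\<close> and \<open>1\<close>.
\<close>

section \<open>Gaussian binomials\<close>

text \<open>
  The factorials are not divided by powers of \<open>1 - Y\<close>; these cancel in Gaussian binomials.
\<close>

definition q_factorial :: "nat \<Rightarrow> 'a::field \<Rightarrow> 'a" where
  "q_factorial d Y = (\<Prod>i = 1..d. 1 - Y ^ i)"

lemma q_factorial_0 [simp]: "q_factorial 0 Y = 1"
  by (simp add: q_factorial_def)

lemma q_factorial_Suc: "q_factorial (Suc d) Y = q_factorial d Y * (1 - Y ^ Suc d)"
  by (simp add: q_factorial_def)

definition not_root_of_unity :: "'a::field \<Rightarrow> bool" where
  "not_root_of_unity Y \<longleftrightarrow> (\<forall>k>0. Y ^ k \<noteq> 1)"

lemma not_root_of_unity_inverse: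
  "not_root_of_unity Y \<Longrightarrow> not_root_of_unity (inverse Y)"
  by (simp add: not_root_of_unity_def power_inverse)

lemma q_factorial_nonzero: "not_root_of_unity Y \<Longrightarrow> q_factorial d Y \<noteq> 0"
  by (auto simp: q_factorial_def not_root_of_unity_def)

text \<open>
  The defining quotient of \<open>gauss_binomial\<close> is meaningful only if no factor \<open>1 - Y^i\<close> vanishes,
  hence the assumption on \<open>Y\<close>.
\<close>

lemma gauss_binomial_eq_q_factorial:
  assumes "not_root_of_unity Y" "b \<le> a"
  shows "gauss_binomial a b Y = q_factorial a Y / (q_factorial b Y * q_factorial (a - b) Y)"
proof -
  have "q_factorial a Y = q_factorial (a - b) Y * (\<Prod>i = a - b + 1..a. 1 - Y ^ i)"
    using prod.ub_add_nat[of 1 "a - b" "\<lambda>i. 1 - Y ^ i" b] assms(2)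
    by (simp add: q_factorial_def)
  then show ?thesis
    using q_factorial_nonzero[OF assms(1)]
    unfolding gauss_binomial_def q_factorial_def[of b Y, symmetric] by simp
qed

lemma gauss_binomial_0 [simp]: "gauss_binomial a 0 Y = 1"
  by (simp add: gauss_binomial_def)

lemma gauss_binomial_self: "not_root_of_unity Y \<Longrightarrow> gauss_binomial a a Y = 1"
  using q_factorial_nonzero[of Y a] by (simp add: gauss_binomial_eq_q_factorial)

text \<open>
  Up to the factor \<open>q_factorial d Y\<close>, the left-hand side is a truncation of the \<open>q\<close>-binomial
  expansion of \<open>(1 - 1) (1 - Y) \<dots> (1 - Y^{d-1})\<close>. Like truncated alternating sums of ordinary
  binomial coefficients, these truncations have a closed form, so that no expansion of a product
  is needed to see that the full sum vanishes.
\<close>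

lemma alternating_q_sum_partial:
  assumes "not_root_of_unity Y" "j < d"
  shows "(\<Sum>k\<le>j. (-1) ^ k * Y ^ (k choose 2) / (q_factorial k Y * q_factorial (d - k) Y)) =
    (-1) ^ j * Y ^ (Suc j choose 2) /
      ((1 - Y ^ d) * q_factorial j Y * q_factorial (d - 1 - j) Y)"
  using assms(2)
proof (induction j)
  case 0
  then obtain e where "d = Suc e"
    by (cases d) auto
  then show ?case
    by (simp add: q_factorial_Suc mult.commute numeral_2_eq_2)
next
  case (Suc j)
  obtain e where d: "d = Suc (Suc (j + e))"
    using Suc.prems by (metis add_Suc less_iff_Suc_add)
  let ?c = "Suc j choose 2"
  have nz: "q_factorial j Y \<noteq> 0" "q_factorial e Y \<noteq> 0" "1 - Y ^ d \<noteq> 0"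
    "1 - Y ^ Suc j \<noteq> 0" "1 - Y ^ Suc e \<noteq> 0"
    using assms(1) q_factorial_nonzero[OF assms(1)]
    unfolding not_root_of_unity_def d by (metis right_minus_eq zero_less_Suc)+
  have choose: "Suc (Suc j) choose 2 = ?c + Suc j"
    by (simp add: numeral_2_eq_2)
  have pd: "Y ^ d = Y ^ Suc j * Y ^ Suc e"
    by (simp add: d power_add)
  have combine: "C / (D * p * E) - C / (p * P * E) = C * (P - D) / (D * (p * P) * E)"
    if "D \<noteq> 0" "P \<noteq> 0" "p \<noteq> 0" "E \<noteq> 0" for C D P p E :: 'a
    using that by (simp add: field_simps)
  have cancel: "C * - (y * e) / (D * (q * e)) = - (C * y) / (D * q)"
    if "e \<noteq> 0" for C y e D q :: 'a
    using that by simp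
  have "(\<Sum>k\<le>Suc j. (-1) ^ k * Y ^ (k choose 2) / (q_factorial k Y * q_factorial (d - k) Y)) =
    (-1) ^ j * Y ^ ?c / ((1 - Y ^ d) * q_factorial j Y * (q_factorial e Y * (1 - Y ^ Suc e)))
    - (-1) ^ j * Y ^ ?c / ((q_factorial j Y * (1 - Y ^ Suc j)) * (q_factorial e Y * (1 - Y ^ Suc e)))"
    unfolding sum.atMost_Suc Suc.IH[OF Suc_lessD[OF Suc.prems]]
    by (simp add: d q_factorial_Suc)
  also have "\<dots> = (-1) ^ j * Y ^ ?c * ((1 - Y ^ Suc j) - (1 - Y ^ d)) /
    ((1 - Y ^ d) * (q_factorial j Y * (1 - Y ^ Suc j)) * (q_factorial e Y * (1 - Y ^ Suc e)))"
    by (rule combine) (use nz in auto)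
  also have "(1 - Y ^ Suc j) - (1 - Y ^ d) = - (Y ^ Suc j * (1 - Y ^ Suc e))"
    by (simp only: pd) (simp add: algebra_simps)
  also have "(-1) ^ j * Y ^ ?c * (- (Y ^ Suc j * (1 - Y ^ Suc e))) /
    ((1 - Y ^ d) * (q_factorial j Y * (1 - Y ^ Suc j)) * (q_factorial e Y * (1 - Y ^ Suc e))) =
    (-1) ^ Suc j * Y ^ (Suc (Suc j) choose 2) /
      ((1 - Y ^ d) * q_factorial (Suc j) Y * q_factorial e Y)"
    unfolding choose power_add q_factorial_Suc cancel[OF nz(5)] by simp
  finally show ?case
    by (simp add: d)
qed

lemma alternating_q_sum:
  assumes "not_root_of_unity Y" "0 < d"
  shows "(\<Sum>k\<le>d. (-1) ^ k * Y ^ (k choose 2) / (q_factorial k Y * q_factorial (d - k) Y)) = 0"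
proof -
  obtain e where d: "d = Suc e"
    using assms(2) by (cases d) auto
  show ?thesis
    using alternating_q_sum_partial[OF assms(1), of e d]
    by (simp add: d q_factorial_Suc mult.commute)
qed

text \<open>
  The matrix of Gaussian binomials is inverted by putting signs and powers of \<open>Y\<close> on its entries:
  \<open>B(b, k) B(k, a)\<close> equals \<open>[b]! / [a]!\<close> times the summand \<open>1 / ([b-k]! [k-a]!)\<close>, which reduces the
  claim to the vanishing alternating sum for \<open>d = b - a\<close>.
\<close>

lemma gauss_binomial_orthogonality:
  assumes "not_root_of_unity Y" "a \<le> b"
  shows "(\<Sum>k = a..b. (-1) ^ (b - k) * Y ^ ((b - k) choose 2) *
    gauss_binomial b k Y * gauss_binomial k a Y) = (if a = b then 1 else 0)"
proof -
  note nz = q_factorial_nonzero[OF assms(1)]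
  let ?t = "\<lambda>k. (-1) ^ k * Y ^ (k choose 2) / (q_factorial k Y * q_factorial (b - a - k) Y)"
  have "(\<Sum>k = a..b. (-1) ^ (b - k) * Y ^ ((b - k) choose 2) *
    gauss_binomial b k Y * gauss_binomial k a Y) =
    (\<Sum>k = a..b. q_factorial b Y / q_factorial a Y * ?t (b - k))"
    using assms nz
    by (intro sum.cong) (auto simp: gauss_binomial_eq_q_factorial field_simps)
  also have "\<dots> = (\<Sum>k\<le>b - a. q_factorial b Y / q_factorial a Y * ?t k)"
    using assms(2)
    by (intro sum.reindex_bij_witness[of _ "\<lambda>k. b - k" "\<lambda>k. b - k"]) auto
  also have "\<dots> = q_factorial b Y / q_factorial a Y * (\<Sum>k\<le>b - a. ?t k)"
    by (simp add: sum_distrib_left)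
  finally show ?thesis
    using alternating_q_sum[OF assms(1), of "b - a"] assms(2) nz
    by (auto simp: binomial_eq_0)
qed

lemma q_factorial_inverse:
  fixes Y :: "'a::field"
  assumes "Y \<noteq> 0"
  shows "q_factorial d (inverse Y) = (-1) ^ d * q_factorial d Y / Y ^ (Suc d choose 2)"
proof (induction d)
  case (Suc d)
  have "1 - inverse Y ^ Suc d = - (1 - Y ^ Suc d) / Y ^ Suc d"
    using assms by (simp add: field_simps)
  moreover have "Suc (Suc d) choose 2 = (Suc d choose 2) + Suc d"
    by (simp add: numeral_2_eq_2)
  ultimately show ?case
    unfolding q_factorial_Suc Suc by (simp only: power_add) (simp add: field_simps)
qed (simp add: numeral_2_eq_2)

lemma choose_two_add: "(a + b) choose 2 = (a choose 2) + (b choose 2) + a * b"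
  by (induction a) (auto simp: numeral_2_eq_2)

text \<open>
  The inverted binomial is \<open>Y^{-u d}\<close> times the original one, with \<open>d = w - u\<close>. The exponent
  splits as \<open>u d = (w choose 2) - (u choose 2) - (d choose 2)\<close>; its first two parts form a
  quotient of two values of \<open>(-1)^u Y^{-(u choose 2)}\<close>, and the third is the weight in the inverse of the
  binomial matrix.
\<close>

lemma gauss_binomial_inverse:
  fixes Y :: "'a::field"
  assumes "not_root_of_unity Y" "Y \<noteq> 0" "u \<le> w"
  shows "gauss_binomial w u (inverse Y) * ((-1) ^ u * inverse Y ^ (u choose 2)) =
    ((-1) ^ w * inverse Y ^ (w choose 2)) *
      ((-1) ^ (w - u) * Y ^ ((w - u) choose 2) * gauss_binomial w u Y)"
proof -
  obtain d where w: "w = u + d"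
    using assms(3) le_Suc_ex by blast
  have choose: "Suc a choose 2 = (a choose 2) + a" for a
    by (simp add: numeral_2_eq_2)
  have "gauss_binomial w u (inverse Y) = ((-1) ^ w * q_factorial w Y / Y ^ (Suc w choose 2)) /
      (((-1) ^ u * q_factorial u Y / Y ^ (Suc u choose 2)) *
       ((-1) ^ d * q_factorial d Y / Y ^ (Suc d choose 2)))"
    using gauss_binomial_eq_q_factorial[OF not_root_of_unity_inverse[OF assms(1)] assms(3)]
    unfolding q_factorial_inverse[OF assms(2)] w by simp
  then show ?thesis
    using assms(2) q_factorial_nonzero[OF assms(1)]
    by (simp add: w gauss_binomial_eq_q_factorial[OF assms(1)] choose choose_two_add power_add field_simps)
qed

section \<open>Sums over words\<close>

abbreviation word_le :: "nat list \<Rightarrow> nat list \<Rightarrow> bool"  (infix "\<preceq>" 50) where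
  "u \<preceq> v \<equiv> list_all2 (\<le>) u v"

lemma word_le_refl [simp]: "u \<preceq> u"
  by (simp add: list_all2_refl)

lemma word_le_trans: "u \<preceq> v \<Longrightarrow> v \<preceq> w \<Longrightarrow> u \<preceq> w"
  by (rule list_all2_trans) auto

lemma word_le_antisym: "u \<preceq> v \<Longrightarrow> v \<preceq> u \<Longrightarrow> u = v"
  by (rule list_all2_antisym) auto

lemma empty_word_le: "length u = length v \<Longrightarrow> empty_word u \<preceq> v"
  by (simp add: empty_word_def list_all2_conv_all_nth)

lemma empty_word_eq: "u \<preceq> v \<Longrightarrow> empty_word u = empty_word v"
  by (simp add: empty_word_def list_all2_lengthD)

lemma finite_subwords [simp]: "finite (subwords w)"
proof (induction w)
  case (Cons a w)
  have "subwords (a # w) \<subseteq> (\<lambda>(x, v). x # v) ` ({..a} \<times> subwords w)"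
    by (auto simp: subwords_def list_all2_Cons2)
  then show ?case
    using Cons by (meson finite_SigmaI finite_atMost finite_imageI finite_subset)
qed (simp add: subwords_def)

lemma self_mem_subwords [simp]: "w \<in> subwords w"
  by (simp add: subwords_def)

lemma sum_list_word_mono: "u \<preceq> v \<Longrightarrow> sum_list u \<le> sum_list v"
  by (induction rule: list_all2_induct) auto

lemma sum_list_word_strict_mono: "u \<preceq> v \<Longrightarrow> u \<noteq> v \<Longrightarrow> sum_list u < sum_list v"
proof (induction rule: list_all2_induct)
  case (Cons x xs y ys)
  then show ?case
    using sum_list_word_mono[of xs ys] by (cases "x = y") auto
qed simp

text \<open>
  Intervals of words are products of intervals of naturals, so a sum of products over an interval
  factors. This lets statements about words be proved one letter at a time.
\<close>

lemma sum_word_interval_prod: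
  fixes f :: "nat \<Rightarrow> nat \<Rightarrow> 'a::comm_semiring_1"
  assumes "u \<preceq> w"
  shows "(\<Sum>v | u \<preceq> v \<and> v \<preceq> w. \<Prod>i<length w. f i (v ! i)) =
    (\<Prod>i<length w. \<Sum>k = u ! i..w ! i. f i k)"
  using assms
proof (induction arbitrary: f rule: list_all2_induct)
  case Nil
  have "{v. [] \<preceq> v \<and> v \<preceq> []} = {[]}"
    by auto
  then show ?case
    by simp
next
  case (Cons a u b w)
  have "(\<Sum>v | a # u \<preceq> v \<and> v \<preceq> b # w. \<Prod>i<length (b # w). f i (v ! i)) =
    (\<Sum>(k, v)\<in>{a..b} \<times> {v. u \<preceq> v \<and> v \<preceq> w}.
      f 0 k * (\<Prod>i<length w. f (Suc i) (v ! i)))"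
    by (intro sum.reindex_bij_witness[of _ "\<lambda>(k, v). k # v" "\<lambda>v. (hd v, tl v)"])
      (auto simp: list_all2_Cons1 list_all2_Cons2 prod.lessThan_Suc_shift simp del: prod.lessThan_Suc)
  also have "\<dots> = (\<Sum>k = a..b. f 0 k) *
    (\<Sum>v | u \<preceq> v \<and> v \<preceq> w. \<Prod>i<length w. f (Suc i) (v ! i))"
    by (simp add: sum_product sum.cartesian_product)
  also have "\<dots> = (\<Prod>i<length (b # w). \<Sum>k = (a # u) ! i..(b # w) ! i. f i k)"
    by (simp add: Cons.IH[of "\<lambda>i. f (Suc i)"] prod.lessThan_Suc_shift del: prod.lessThan_Suc)
  finally show ?case .
qed

definition word_binomial :: "nat list \<Rightarrow> nat list \<Rightarrow> (nat \<Rightarrow> 'a::field) \<Rightarrow> 'a" where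
  "word_binomial w u Y = (\<Prod>i<length w. gauss_binomial (w ! i) (u ! i) (Y i))"

text \<open>
  The factor relating the matrix \<open>word_binomial\<close> to its inverse.
\<close>

definition word_q_sign :: "nat list \<Rightarrow> nat list \<Rightarrow> (nat \<Rightarrow> 'a::field) \<Rightarrow> 'a" where
  "word_q_sign w u Y =
    (\<Prod>i<length w. (-1) ^ (w ! i - u ! i) * Y i ^ ((w ! i - u ! i) choose 2))"

text \<open>
  Substituting the hypothesis into the right-hand side and exchanging the sums leaves, for each
  \<open>u\<close>, a sum over the interval from \<open>u\<close> to \<open>w\<close>. It is the product over the letters of the
  one-variable orthogonality sums, hence \<open>1\<close> for \<open>u = w\<close> and \<open>0\<close> otherwise.
\<close>

lemma gauss_inversion:
  fixes Y :: "nat \<Rightarrow> 'a::field"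
  assumes "\<And>i. i < length w \<Longrightarrow> not_root_of_unity (Y i)"
    and f: "\<And>v. v \<preceq> w \<Longrightarrow> f v = (\<Sum>u\<in>subwords v. word_binomial v u Y * g u)"
  shows "g w = (\<Sum>v\<in>subwords w. word_q_sign w v Y * word_binomial w v Y * f v)"
proof -
  let ?K = "\<lambda>v. word_q_sign w v Y * word_binomial w v Y"
  have orth: "(\<Sum>v | u \<preceq> v \<and> v \<preceq> w. ?K v * word_binomial v u Y) = (if u = w then 1 else 0)"
    if u: "u \<preceq> w" for u
  proof -
    have len: "length u = length w"
      using u by (rule list_all2_lengthD)
    have "(\<Sum>v | u \<preceq> v \<and> v \<preceq> w. ?K v * word_binomial v u Y) =
      (\<Sum>v | u \<preceq> v \<and> v \<preceq> w. \<Prod>i<length w.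
        (-1) ^ (w ! i - v ! i) * Y i ^ ((w ! i - v ! i) choose 2) *
        gauss_binomial (w ! i) (v ! i) (Y i) * gauss_binomial (v ! i) (u ! i) (Y i))"
      by (rule sum.cong)
        (auto simp: word_q_sign_def word_binomial_def prod.distrib dest: list_all2_lengthD)
    also have "\<dots> = (\<Prod>i<length w. \<Sum>k = u ! i..w ! i.
        (-1) ^ (w ! i - k) * Y i ^ ((w ! i - k) choose 2) *
        gauss_binomial (w ! i) k (Y i) * gauss_binomial k (u ! i) (Y i))"
      by (rule sum_word_interval_prod[OF u])
    also have "\<dots> = (\<Prod>i<length w. if u ! i = w ! i then 1 else 0)"
      using u assms(1)
      by (intro prod.cong refl gauss_binomial_orthogonality) (auto simp: list_all2_conv_all_nth)
    also have "\<dots> = (if u = w then 1 else 0)"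
      using len by (auto simp: list_eq_iff_nth_eq)
    finally show ?thesis .
  qed
  have "(\<Sum>v\<in>subwords w. ?K v * f v) =
    (\<Sum>v\<in>subwords w. \<Sum>u\<in>{u \<in> subwords w. u \<preceq> v}. ?K v * word_binomial v u Y * g u)"
  proof (rule sum.cong[OF refl])
    fix v assume v: "v \<in> subwords w"
    then have "{u \<in> subwords w. u \<preceq> v} = subwords v"
      by (auto simp: subwords_def intro: word_le_trans)
    then show "?K v * f v =
        (\<Sum>u\<in>{u \<in> subwords w. u \<preceq> v}. ?K v * word_binomial v u Y * g u)"
      using v f[of v] by (simp add: subwords_def sum_distrib_left mult.assoc)
  qed
  also have "\<dots> =
    (\<Sum>u\<in>subwords w. \<Sum>v\<in>{v \<in> subwords w. u \<preceq> v}. ?K v * word_binomial v u Y * g u)"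
    by (rule sum.swap_restrict) simp_all
  also have "\<dots> = (\<Sum>u\<in>subwords w. (\<Sum>v | u \<preceq> v \<and> v \<preceq> w. ?K v * word_binomial v u Y) * g u)"
    by (simp add: sum_distrib_right subwords_def conj_commute)
  also have "\<dots> = (\<Sum>u\<in>subwords w. if u = w then g u else 0)"
    by (intro sum.cong) (auto simp: orth subwords_def)
  also have "\<dots> = g w"
    by simp
  finally show ?thesis ..
qed

section \<open>Flags with a prescribed top\<close>

text \<open>
  Inserting the empty word gives the empty flag the top \<open>0\<close>, so that every flag has exactly one
  top and the recursion needs no separate term for the empty flag.
\<close>

definition flags_with_top :: "nat list \<Rightarrow> nat list set set" where
  "flags_with_top u = {V \<in> WO u. u \<in> insert (empty_word u) V}"

lemma finite_WO [simp]: "finite (WO n)"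
  by (rule finite_subset[of _ "Pow (subwords n)"]) (auto simp: WO_def)

lemma WO_subset: "V \<in> WO n \<Longrightarrow> V \<subseteq> subwords n"
  by (auto simp: WO_def)

lemma WO_mono:
  assumes "u \<preceq> n"
  shows "WO u \<subseteq> WO n"
  using assms by (auto simp: WO_def subwords_def empty_word_eq intro: word_le_trans)

text \<open>
  In a chain the word of largest total length is comparable with all others, hence above them.
\<close>

lemma WO_ex_top:
  assumes "V \<in> WO n"
  obtains u where "u \<in> subwords n" "V \<in> flags_with_top u"
proof -
  let ?V = "insert (empty_word n) V"
  have fin: "finite ?V"
    using WO_subset[OF assms] finite_subset[OF _ finite_subwords] by blast
  then have "Max (sum_list ` ?V) \<in> sum_list ` ?V"
    by (intro Max_in) auto
  then obtain u where u: "u \<in> ?V" "sum_list u = Max (sum_list ` ?V)"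
    by (metis imageE)
  have max: "sum_list v \<le> sum_list u" if "v \<in> ?V" for v
    unfolding u(2) using fin that by (intro Max_ge) auto
  have un: "u \<preceq> n"
    using u(1) WO_subset[OF assms] by (auto simp: subwords_def empty_word_le)
  have "v \<preceq> u" if "v \<in> V" for v
  proof -
    have "v \<preceq> n"
      using that WO_subset[OF assms] by (auto simp: subwords_def)
    then have "empty_word n \<preceq> v"
      by (simp add: empty_word_le list_all2_lengthD)
    then have "v \<preceq> u \<or> u \<preceq> v"
      using u(1) that assms by (auto simp: WO_def chain_def)
    then show ?thesis
      using max[of v] that sum_list_word_strict_mono[of u v] by fastforce
  qed
  then have "V \<in> flags_with_top u"
    using assms u(1) un empty_word_eq[OF un] by (auto simp: flags_with_top_def WO_def subwords_def)
  with un show thesis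
    using that by (auto simp: subwords_def)
qed

lemma flags_with_top_unique:
  assumes "V \<in> flags_with_top u" "V \<in> flags_with_top u'" "length u = length u'"
  shows "u = u'"
proof -
  have "u \<preceq> u'" if "V \<in> flags_with_top u" "V \<in> flags_with_top u'" "length u = length u'" for u u'
    using that empty_word_le[of u u'] by (auto simp: flags_with_top_def WO_def subwords_def)
  then show ?thesis
    using assms by (metis word_le_antisym)
qed

lemma WO_eq_Union_flags_with_top: "WO n = (\<Union>u\<in>subwords n. flags_with_top u)"
proof -
  have "flags_with_top u \<subseteq> WO n" if "u \<in> subwords n" for u
    using that WO_mono[of u n] by (auto simp: flags_with_top_def subwords_def)
  moreover have "V \<in> (\<Union>u\<in>subwords n. flags_with_top u)" if "V \<in> WO n" for V
    using WO_ex_top[OF that] by blast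
  ultimately show ?thesis
    by blast
qed

lemma gauss_multinomial_insert:
  assumes "finite J" "\<And>x. x \<in> J \<Longrightarrow> x < j"
  shows "gauss_multinomial k (insert j J) Y = gauss_binomial k j Y * gauss_multinomial j J Y"
proof -
  let ?L = "sorted_list_of_set J"
  have L: "sorted_list_of_set (insert j J) = ?L @ [j]"
  proof (rule sorted_distinct_set_unique)
    show "sorted (sorted_list_of_set (insert j J))"
      by (rule sorted_sorted_list_of_set)
    show "distinct (sorted_list_of_set (insert j J))"
      by (rule distinct_sorted_list_of_set)
    show "set (sorted_list_of_set (insert j J)) = set (?L @ [j])"
      using assms(1) by (subst set_sorted_list_of_set) auto
    show "sorted (?L @ [j])"
      using assms by (auto simp: sorted_append less_imp_le)
    show "distinct (?L @ [j])"
      using assms by auto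
  qed
  have len: "length ?L = card J"
    by simp
  have "(\<Prod>s<card J. gauss_binomial ((?L @ [j, k]) ! (s + 1)) ((?L @ [j, k]) ! s) Y) =
    (\<Prod>s<card J. gauss_binomial ((?L @ [j]) ! (s + 1)) ((?L @ [j]) ! s) Y)"
  proof (rule prod.cong[OF refl])
    fix s assume s: "s \<in> {..<card J}"
    have "(?L @ [j, k]) ! t = (?L @ [j]) ! t" if "t \<le> card J" for t
      using that len by (cases "t = card J") (auto simp: nth_append)
    then show "gauss_binomial ((?L @ [j, k]) ! (s + 1)) ((?L @ [j, k]) ! s) Y =
      gauss_binomial ((?L @ [j]) ! (s + 1)) ((?L @ [j]) ! s) Y"
      using s by simp
  qed
  moreover have "card (insert j J) = Suc (card J)"
    using assms by (metis card_insert_disjoint less_irrefl)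
  ultimately show ?thesis
    by (simp add: gauss_multinomial_def L nth_append len mult.commute)
qed

text \<open>
  Splitting off the binomial of \<open>k\<close> over \<open>j\<close> remains correct at the ends \<open>j = 0\<close> and \<open>j = k\<close>, which
  the definition of a projected flag discards: there the binomial is \<open>1\<close>. This is why a word of a
  flag may agree with the top, or with the empty word, in some letters.
\<close>

lemma gauss_multinomial_truncate:
  assumes "not_root_of_unity Y" "P \<subseteq> {..j}" "j \<in> P \<or> j = 0" "j \<le> k"
  shows "gauss_multinomial k (P \<inter> {1..k - 1}) Y =
    gauss_binomial k j Y * gauss_multinomial j (P \<inter> {1..j - 1}) Y"
proof -
  consider "j = 0" | "j = k" | "0 < j" "j < k"
    using assms(4) by linarith
  then show ?thesis
  proof cases
    case 1
    then have "P \<inter> {1..k - 1} = {}"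
      using assms(2) by auto
    with 1 show ?thesis
      by (simp add: gauss_multinomial_def)
  next
    case 2
    then show ?thesis
      using assms(1) by (simp add: gauss_binomial_self)
  next
    case 3
    then have "P \<inter> {1..k - 1} = insert j (P \<inter> {1..j - 1})"
      using assms(2,3) by force
    then show ?thesis
      by (simp only:) (rule gauss_multinomial_insert, use assms(2) in auto)
  qed
qed

lemma flag_multinomial_with_top:
  assumes "\<And>i. i < length n \<Longrightarrow> not_root_of_unity (Y i)" "u \<preceq> n" "V \<in> flags_with_top u"
  shows "flag_multinomial n V Y = word_binomial n u Y * flag_multinomial u V Y"
proof -
  have len: "length u = length n"
    using assms(2) by (rule list_all2_lengthD)
  have "gauss_multinomial (n ! i) (flag_proj n V i) (Y i) =
    gauss_binomial (n ! i) (u ! i) (Y i) * gauss_multinomial (u ! i) (flag_proj u V i) (Y i)"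
    if "i < length n" for i
    unfolding flag_proj_def
  proof (rule gauss_multinomial_truncate)
    show "(\<lambda>v. v ! i) ` V \<subseteq> {..u ! i}"
      using assms(3) that len
      by (auto simp: flags_with_top_def WO_def subwords_def list_all2_conv_all_nth)
    show "u ! i \<in> (\<lambda>v. v ! i) ` V \<or> u ! i = 0"
      using assms(3) that len by (auto simp: flags_with_top_def empty_word_def)
    show "u ! i \<le> n ! i"
      using assms(2) that by (simp add: list_all2_conv_all_nth)
  qed (use assms(1) that in auto)
  then show ?thesis
    by (simp add: flag_multinomial_def word_binomial_def len flip: prod.distrib)
qed

section \<open>The recursion for generalized Igusa functions\<close>

text \<open>
  The family \<open>X\<close> with value \<open>1\<close> at the empty word, which carries no factor in flag weights.
\<close>

definition rooted_var :: "(nat list \<Rightarrow> 'a::field) \<Rightarrow> nat list \<Rightarrow> 'a" where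
  "rooted_var X u = (if u = empty_word u then 1 else X u)"

lemma WO_empty_word:
  assumes "w = empty_word w"
  shows "WO w = {{}}"
proof -
  have "subwords w \<subseteq> {empty_word w}"
    using assms empty_word_le[of w] by (auto simp: subwords_def list_all2_lengthD intro!: word_le_antisym)
  then show ?thesis
    by (auto simp: WO_def chain_def)
qed

lemma igusa_wo_empty_word:
  assumes "w = empty_word w"
  shows "igusa_wo w Y X = 1"
  using WO_empty_word[OF assms]
  by (simp add: igusa_wo_def flag_multinomial_def flag_weight_def gauss_multinomial_def flag_proj_def)

text \<open>
  For nonempty \<open>w\<close> let \<open>S\<close> be the sum over the flags that avoid \<open>w\<close>, and \<open>x = X w / (1 - X w)\<close>. Adding
  \<open>w\<close> to a flag keeps its multinomial and multiplies its weight by \<open>x\<close>. So the flags with top \<open>w\<close>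
  contribute \<open>x S\<close>, all flags contribute \<open>(1 + x) S\<close>, and \<open>x = X w (1 + x)\<close>.
\<close>

lemma sum_flags_with_top:
  fixes X :: "nat list \<Rightarrow> 'a::field"
  assumes "w \<noteq> empty_word w \<Longrightarrow> X w \<noteq> 1"
  shows "(\<Sum>V\<in>flags_with_top w. flag_multinomial w V Y * flag_weight V X) =
    rooted_var X w * igusa_wo w Y X"
proof (cases "w = empty_word w")
  case True
  then have "flags_with_top w = WO w"
    by (auto simp: flags_with_top_def)
  then show ?thesis
    using True by (simp add: rooted_var_def flip: igusa_wo_def)
next
  case False
  define B where "B = {V \<in> WO w. w \<notin> V}"
  define x where "x = X w / (1 - X w)"
  let ?S = "\<Sum>V\<in>B. flag_multinomial w V Y * flag_weight V X"
  have fin: "finite V" if "V \<in> WO w" for V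
    using WO_subset[OF that] finite_subset[OF _ finite_subwords] by blast
  have top: "flags_with_top w = insert w ` B"
  proof (intro equalityI subsetI)
    fix V assume V: "V \<in> flags_with_top w"
    then have "V - {w} \<in> B" "insert w (V - {w}) = V"
      using False by (auto simp: B_def flags_with_top_def WO_def chain_def)
    then show "V \<in> insert w ` B"
      by (metis imageI)
  next
    fix V assume "V \<in> insert w ` B"
    then show "V \<in> flags_with_top w"
      using False by (auto simp: B_def flags_with_top_def WO_def chain_def subwords_def)
  qed
  have inj: "inj_on (insert w) B"
    by (auto simp: inj_on_def B_def)
  have "flag_multinomial w (insert w V) Y = flag_multinomial w V Y" for V
  proof -
    have "flag_proj w (insert w V) i = flag_proj w V i" for i
      by (auto simp: flag_proj_def)
    then show ?thesis
      by (simp add: flag_multinomial_def)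
  qed
  moreover have "flag_weight (insert w V) X = x * flag_weight V X" if "V \<in> B" for V
    using that fin by (simp add: B_def flag_weight_def x_def)
  ultimately have T: "(\<Sum>V\<in>flags_with_top w. flag_multinomial w V Y * flag_weight V X) = x * ?S"
    by (simp add: top sum.reindex[OF inj] sum_distrib_left algebra_simps)
  have "WO w = B \<union> flags_with_top w" "B \<inter> flags_with_top w = {}"
    using False by (auto simp: B_def flags_with_top_def)
  then have I: "igusa_wo w Y X = (1 + x) * ?S"
    unfolding igusa_wo_def using finite_WO[of w] T by (simp add: sum.union_disjoint distrib_right)
  have "x = X w * (1 + x)"
    using False assms by (simp add: x_def field_simps)
  then have "x * ?S = X w * (1 + x) * ?S"
    by (rule arg_cong)
  then show ?thesis
    unfolding T I using False by (simp add: rooted_var_def mult.assoc)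
qed

lemma igusa_wo_recursion:
  fixes X :: "nat list \<Rightarrow> 'a::field"
  assumes "\<And>i. i < length w \<Longrightarrow> not_root_of_unity (Y i)"
    and "\<And>u. u \<preceq> w \<Longrightarrow> u \<noteq> empty_word u \<Longrightarrow> X u \<noteq> 1"
  shows "igusa_wo w Y X =
    (\<Sum>u\<in>subwords w. word_binomial w u Y * (rooted_var X u * igusa_wo u Y X))"
proof -
  have "igusa_wo w Y X =
    (\<Sum>u\<in>subwords w. \<Sum>V\<in>flags_with_top u. flag_multinomial w V Y * flag_weight V X)"
    unfolding igusa_wo_def WO_eq_Union_flags_with_top[of w]
  proof (rule sum.UNION_disjoint)
    show "\<forall>u\<in>subwords w. finite (flags_with_top u)"
      by (simp add: flags_with_top_def)
    show "\<forall>u\<in>subwords w. \<forall>v\<in>subwords w. u \<noteq> v \<longrightarrow> flags_with_top u \<inter> flags_with_top v = {}"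
      using flags_with_top_unique by (fastforce simp: subwords_def dest: list_all2_lengthD)
  qed simp
  also have "\<dots> = (\<Sum>u\<in>subwords w. word_binomial w u Y *
    (\<Sum>V\<in>flags_with_top u. flag_multinomial u V Y * flag_weight V X))"
    using assms(1)
    by (intro sum.cong) (auto simp: subwords_def sum_distrib_left flag_multinomial_with_top mult.assoc)
  also have "\<dots> =
    (\<Sum>u\<in>subwords w. word_binomial w u Y * (rooted_var X u * igusa_wo u Y X))"
    using assms(2) by (intro sum.cong) (auto simp: sum_flags_with_top subwords_def)
  finally show ?thesis .
qed

text \<open>
  For nonempty \<open>v\<close> the term \<open>u = v\<close> of the sum is \<open>X v * f v\<close>. Moving it to the left-hand side gives
  \<open>f v * (1 - X v)\<close> in terms of values at smaller words.
\<close>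

lemma word_recursion_unique:
  fixes Y :: "nat \<Rightarrow> 'a::field"
  assumes Y: "\<And>i. i < length w \<Longrightarrow> not_root_of_unity (Y i)"
    and X: "\<And>u. u \<preceq> w \<Longrightarrow> u \<noteq> empty_word u \<Longrightarrow> X u \<noteq> 1"
    and f: "\<And>v. v \<preceq> w \<Longrightarrow>
      f v = (\<Sum>u\<in>subwords v. word_binomial v u Y * (rooted_var X u * f u))"
    and g: "\<And>v. v \<preceq> w \<Longrightarrow>
      g v = (\<Sum>u\<in>subwords v. word_binomial v u Y * (rooted_var X u * g u))"
    and empty: "f (empty_word w) = g (empty_word w)"
  shows "f w = g w"
proof -
  have "f v = g v" if "v \<preceq> w" for v
    using that
  proof (induction v rule: measure_induct_rule[of sum_list])
    case (less v)
    note vw = less.prems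
    show ?case
    proof (cases "v = empty_word v")
      case True
      then show ?thesis
        using empty empty_word_eq[OF vw] by simp
    next
      case False
      have diag: "word_binomial v v Y = 1"
        using Y list_all2_lengthD[OF vw] by (simp add: word_binomial_def gauss_binomial_self)
      have split: "h v * (1 - X v) =
          (\<Sum>u\<in>subwords v - {v}. word_binomial v u Y * (rooted_var X u * h u))"
        if "h v = (\<Sum>u\<in>subwords v. word_binomial v u Y * (rooted_var X u * h u))" for h
      proof -
        have "h v = X v * h v +
            (\<Sum>u\<in>subwords v - {v}. word_binomial v u Y * (rooted_var X u * h u))"
          using trans[OF that sum.remove[OF finite_subwords self_mem_subwords]] False diag
          by (simp add: rooted_var_def)
        then show ?thesis
          by (simp add: algebra_simps)
      qed
      have "f u = g u" if "u \<in> subwords v - {v}" for u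
        using that less.IH[of u] vw sum_list_word_strict_mono[of u v]
        by (auto simp: subwords_def intro: word_le_trans)
      then have "f v * (1 - X v) = g v * (1 - X v)"
        unfolding split[OF f[OF vw]] split[OF g[OF vw]] by simp
      then show ?thesis
        using X[OF vw False] by simp
    qed
  qed
  then show ?thesis
    by simp
qed

section \<open>The functional equation\<close>

definition word_reflection :: "nat list \<Rightarrow> (nat \<Rightarrow> 'a::field) \<Rightarrow> 'a" where
  "word_reflection w Y = (\<Prod>i<length w. (-1) ^ (w ! i) * inverse (Y i) ^ (w ! i choose 2))"

lemma word_binomial_inverse:
  assumes "\<And>i. i < length w \<Longrightarrow> not_root_of_unity (Y i)" "\<And>i. i < length w \<Longrightarrow> Y i \<noteq> 0" "u \<preceq> w"
  shows "word_binomial w u (\<lambda>i. inverse (Y i)) * word_reflection u Y =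
    word_reflection w Y * (word_q_sign w u Y * word_binomial w u Y)"
proof -
  have len: "length u = length w"
    using assms(3) by (rule list_all2_lengthD)
  show ?thesis
    unfolding word_binomial_def word_reflection_def word_q_sign_def len prod.distrib[symmetric]
    by (intro prod.cong refl gauss_binomial_inverse) (use assms in \<open>auto simp: list_all2_conv_all_nth\<close>)
qed

text \<open>
  For the empty word both sides are \<open>1\<close>; using \<open>rooted_var\<close> instead of \<open>X\<close> makes the equation true
  there as well, which starts the recursion.
\<close>

theorem igusa_wo_functional_equation:
  fixes X :: "nat list \<Rightarrow> 'a::field"
  assumes Y: "\<And>i. i < length n \<Longrightarrow> not_root_of_unity (Y i)" "\<And>i. i < length n \<Longrightarrow> Y i \<noteq> 0"
    and X: "\<And>v. v \<preceq> n \<Longrightarrow> v \<noteq> empty_word v \<Longrightarrow> X v \<noteq> 0 \<and> X v \<noteq> 1"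
  shows "igusa_wo n (\<lambda>i. inverse (Y i)) (\<lambda>v. inverse (X v)) =
    word_reflection n Y * rooted_var X n * igusa_wo n Y X"
proof -
  let ?Y = "\<lambda>i. inverse (Y i)" and ?X = "\<lambda>v. inverse (X v)"
  \<comment> \<open>The candidate for the Igusa function at the inverted variables.\<close>
  define g where "g v = word_reflection v Y * (rooted_var X v * igusa_wo v Y X)" for v
  have "igusa_wo n ?Y ?X = g n"
  proof (rule word_recursion_unique[of n ?Y ?X "\<lambda>v. igusa_wo v ?Y ?X" g])
    show "igusa_wo v ?Y ?X =
        (\<Sum>u\<in>subwords v. word_binomial v u ?Y * (rooted_var ?X u * igusa_wo u ?Y ?X))"
      if v: "v \<preceq> n" for v
      using Y X list_all2_lengthD[OF v]
      by (intro igusa_wo_recursion) (auto simp: not_root_of_unity_inverse dest: word_le_trans[OF _ v])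
    show "g v = (\<Sum>u\<in>subwords v. word_binomial v u ?Y * (rooted_var ?X u * g u))"
      if v: "v \<preceq> n" for v
    proof -
      have Yv: "not_root_of_unity (Y i)" "Y i \<noteq> 0" if "i < length v" for i
        using that Y list_all2_lengthD[OF v] by auto
      have "rooted_var X v * igusa_wo v Y X =
          (\<Sum>u\<in>subwords v. word_q_sign v u Y * word_binomial v u Y * igusa_wo u Y X)"
      proof (rule gauss_inversion)
        fix t assume t: "t \<preceq> v"
        show "igusa_wo t Y X =
            (\<Sum>u\<in>subwords t. word_binomial t u Y * (rooted_var X u * igusa_wo u Y X))"
          using Yv X list_all2_lengthD[OF t]
          by (intro igusa_wo_recursion) (auto dest: word_le_trans[OF word_le_trans[OF _ t] v])
      qed (rule Yv)
      then have "g v = (\<Sum>u\<in>subwords v.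
          word_reflection v Y * (word_q_sign v u Y * word_binomial v u Y) * igusa_wo u Y X)"
        by (simp add: g_def sum_distrib_left mult.assoc)
      also have "\<dots> = (\<Sum>u\<in>subwords v. word_binomial v u ?Y * (rooted_var ?X u * g u))"
      proof (rule sum.cong[OF refl])
        fix u assume "u \<in> subwords v"
        then have u: "u \<preceq> v"
          by (simp add: subwords_def)
        have "rooted_var ?X u * rooted_var X u = 1"
          using X word_le_trans[OF u v] by (simp add: rooted_var_def)
        then have "rooted_var ?X u * g u = word_reflection u Y * igusa_wo u Y X"
          unfolding g_def by (metis (no_types, lifting) mult.assoc mult.left_commute mult_1)
        then show "word_reflection v Y * (word_q_sign v u Y * word_binomial v u Y) * igusa_wo u Y X =
            word_binomial v u ?Y * (rooted_var ?X u * g u)"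
          using word_binomial_inverse[of v Y u] Yv u by (simp add: mult.assoc[symmetric])
      qed
      finally show ?thesis .
    qed
    show "igusa_wo (empty_word n) ?Y ?X = g (empty_word n)"
    proof -
      have e: "empty_word n = empty_word (empty_word n)"
        by (simp add: empty_word_def)
      have "word_reflection (empty_word n) Y = 1"
        by (auto simp: word_reflection_def empty_word_def binomial_eq_0
          intro!: prod.neutral)
      then show ?thesis
        by (simp add: g_def rooted_var_def igusa_wo_empty_word[OF e] flip: e)
    qed
  qed (use Y X in \<open>auto simp: not_root_of_unity_inverse\<close>)
  then show ?thesis
    by (simp add: g_def mult.assoc)
qed

text \<open>
  What remains is to see that variables of the field of rational functions are admissible values.
\<close>

lemma variable_power:
  "variable x ^ k = Fract (Poly_Mapping.single (Poly_Mapping.single x k) 1) 1"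
proof (induction k)
  case 0
  then show ?case
    by (simp add: One_fract_def)
next
  case (Suc k)
  then show ?case
    by (simp add: variable_def mult_single single_add[symmetric])
qed

lemma not_root_of_unity_variable: "not_root_of_unity (variable x)"
  unfolding not_root_of_unity_def
proof (intro allI impI notI)
  fix k :: nat
  assume "0 < k" "variable x ^ k = 1"
  then have "Poly_Mapping.single (Poly_Mapping.single x k) (1::rat) = 1"
    by (simp add: variable_power One_fract_def eq_fract)
  \<comment> \<open>Compare constant coefficients: the exponent \<open>0\<close> is the monomial \<open>1\<close>.\<close>
  then have "Poly_Mapping.lookup (Poly_Mapping.single (Poly_Mapping.single x k) (1::rat)) 0 = 1"
    by simp
  then have "Poly_Mapping.single x k = 0"
    by (simp add: lookup_single when_def split: if_splits)
  then have "Poly_Mapping.lookup (Poly_Mapping.single x k) x = 0"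
    by simp
  with \<open>0 < k\<close> show False
    by simp
qed

lemma variable_nonzero: "variable x \<noteq> 0"
  by (simp add: variable_def Zero_fract_def eq_fract)
    (metis lookup_single_eq lookup_zero zero_neq_one)

theorem theorem3p8:
  fixes n :: "nat list" and m N :: nat
  assumes "length n = m" and "(\<Sum>i<m. n ! i) = N" and "N \<ge> 1"
  shows "igusa_wo n (\<lambda>i. inverse (gen_Y i)) (\<lambda>v. inverse (gen_X v)) =
    (-1) ^ N * gen_X n * (\<Prod>i<m. inverse (gen_Y i) ^ (n ! i choose 2)) * igusa_wo n gen_Y gen_X"
proof -
  have "n \<noteq> empty_word n"
  proof
    assume "n = empty_word n"
    then have "n ! i = 0" if "i < m" for i
    proof -
      have "n ! i = empty_word n ! i"
        using \<open>n = empty_word n\<close> by (rule arg_cong)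
      then show ?thesis
        using that assms(1) by (simp add: empty_word_def)
    qed
    then show False
      using assms(2,3) by simp
  qed
  then have "rooted_var gen_X n = gen_X n"
    by (simp add: rooted_var_def)
  moreover have "word_reflection n gen_Y =
      (-1) ^ N * (\<Prod>i<m. inverse (gen_Y i) ^ (n ! i choose 2))"
    using assms(1,2) by (simp add: word_reflection_def prod.distrib flip: power_sum)
  moreover have "gen_X v \<noteq> 0 \<and> gen_X v \<noteq> 1" for v
    using not_root_of_unity_variable[of "XVar v"]
    by (auto simp: gen_X_def variable_nonzero not_root_of_unity_def dest: spec[of _ 1])
  ultimately show ?thesis
    using igusa_wo_functional_equation[of n gen_Y gen_X]
    by (simp add: gen_Y_def variable_nonzero not_root_of_unity_variable mult_ac)
qed

end
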